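(* Let $J,R,Q\in\mathbb{R}^{n\times n}$ with $J$ skew-symmetric, $R$ symmetric positive semidefinite, $Q$ symmetric positive definite, let $B\in\mathbb{R}^{n\times m}$ have full rank $m\le n$, and let $\mathbb{U}=[\underline{u}_1,\overline{u}_1]\times\dots\times[\underline{u}_m,\overline{u}_m]\subset\mathbb{R}^m$ with $0\in\operatorname{int}(\mathbb{U})$. If $(\hat x,\hat u,\hat\lambda)\in\mathbb{R}^n\times\mathbb{U}\times\mathbb{R}^n$ is an optimal steady state (with associated Lagrange multiplier $\hat\lambda$), then $$B^\top(Q\hat x+\hat\lambda)=0\quad\text{and}\quad J(Q\hat x+\hat\lambda)=R\hat\lambda=RQ\hat x=0.$$ In particular, if $J-R$ is invertible or $((J-R)Q,B)$ is controllable, then $Q\hat x+\hat\lambda=0$ holds.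
   Context: The steady-state problem is $$\min_{\hat u\in\mathbb{U}}\ \hat u^\top\hat y\quad\text{s.t.}\quad 0=(J-R)Q\hat x+B\hat u,\quad \hat y=B^\top Q\hat x .$$ That $(\hat x,\hat u,\hat\lambda)$ is an optimal steady state means that $(\hat x,\hat u)$ solves this problem and $\hat\lambda\in\mathbb{R}^n$ is a Lagrange multiplier satisfying, together with $(\hat x,\hat u)$, the first-order necessary conditions $$0=(J-R)Q\hat x+B\hat u,\qquad 0=-B\hat u+(J+R)\hat\lambda,\qquad \hat u^\top\big(B^\top(Q\hat x+\hat\lambda)\big)\le\tilde u^\top\big(B^\top(Q\hat x+\hat\lambda)\big)\ \ \forall\,\tilde u\in\mathbb{U}.$$ Controllability of $(A,B)$ means $\operatorname{rank}(B,AB,\dots,A^{n-1}B)=n$. *)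

theory Defs
  imports "HOL-Analysis.Analysis"
begin

definition symmetric_matrix :: "real^'n^'n \<Rightarrow> bool" where
  "symmetric_matrix A \<longleftrightarrow> transpose A = A"

definition skew_symmetric_matrix :: "real^'n^'n \<Rightarrow> bool" where
  "skew_symmetric_matrix A \<longleftrightarrow> transpose A = - A"

definition sym_pos_semidef :: "real^'n^'n \<Rightarrow> bool" where
  "sym_pos_semidef A \<longleftrightarrow> symmetric_matrix A \<and> (\<forall>x. 0 \<le> x \<bullet> (A *v x))"

definition sym_pos_def :: "real^'n^'n \<Rightarrow> bool" where
  "sym_pos_def A \<longleftrightarrow> symmetric_matrix A \<and> (\<forall>x. x \<noteq> 0 \<longrightarrow> 0 < x \<bullet> (A *v x))"

(* The power operator on type vec would be componentwise, hence a separate matrix power. *)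
primrec matrix_power :: "real^'n^'n \<Rightarrow> nat \<Rightarrow> real^'n^'n" where
  "matrix_power A 0 = mat 1"
| "matrix_power A (Suc k) = A ** matrix_power A k"

(* The block matrix (B, AB, ..., A^(n-1) B). Its columns are indexed by pairs (k, j): block k,
   column j of that block. Block labels range over 'n and are numbered 0, ..., n-1 by the
   bijection to_nat_on UNIV, so the choice of numbering only permutes columns. *)
definition controllability_matrix ::
    "real^'n^'n \<Rightarrow> real^'m^'n \<Rightarrow> real^('n \<times> 'm)^'n" where
  "controllability_matrix A B =
     (\<chi> i p. (matrix_power A (to_nat_on (UNIV :: 'n set) (fst p)) ** B) $ i $ snd p)"

definition controllable :: "real^'n^'n \<Rightarrow> real^'m^'n \<Rightarrow> bool" where
  "controllable (A :: real^'n^'n) B \<longleftrightarrow> rank (controllability_matrix A B) = CARD('n)"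

lemma columns_controllability_matrix:
  fixes A :: "real^'n^'n" and B :: "real^'m^'n"
  shows "columns (controllability_matrix A B) =
    {column j (matrix_power A k ** B) | k j. k < CARD('n)}"
proof -
  let ?e = "to_nat_on (UNIV :: 'n set)"
  have e: "range ?e = {..<CARD('n)}"
    using to_nat_on_finite[of "UNIV :: 'n set"] by (simp add: bij_betw_def)
  have col: "column p (controllability_matrix A B) =
      column (snd p) (matrix_power A (?e (fst p)) ** B)" for p
    by (simp add: column_def controllability_matrix_def vec_eq_iff)
  have "columns (controllability_matrix A B) =
      {column j (matrix_power A k ** B) | k j. k \<in> range ?e}"
    unfolding columns_def col by force
  then show ?thesis
    by (simp add: e)
qed

definition steady_state ::
    "real^'n^'n \<Rightarrow> real^'n^'n \<Rightarrow> real^'n^'n \<Rightarrow> real^'m^'n \<Rightarrow> real^'n \<Rightarrow> real^'m \<Rightarrow> bool" where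
  "steady_state J R Q B x u \<longleftrightarrow> 0 = ((J - R) ** Q) *v x + B *v u"

definition steady_output ::
    "real^'n^'n \<Rightarrow> real^'m^'n \<Rightarrow> real^'n \<Rightarrow> real^'m" where
  "steady_output Q B x = (transpose B ** Q) *v x"

definition solves_steady_state_problem ::
    "real^'n^'n \<Rightarrow> real^'n^'n \<Rightarrow> real^'n^'n \<Rightarrow> real^'m^'n \<Rightarrow> (real^'m) set \<Rightarrow>
     real^'n \<Rightarrow> real^'m \<Rightarrow> bool" where
  "solves_steady_state_problem J R Q B U x u \<longleftrightarrow>
     u \<in> U \<and> steady_state J R Q B x u \<and>
     (\<forall>x' u'. u' \<in> U \<and> steady_state J R Q B x' u' \<longrightarrow>
        u \<bullet> steady_output Q B x \<le> u' \<bullet> steady_output Q B x')"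

definition first_order_conditions ::
    "real^'n^'n \<Rightarrow> real^'n^'n \<Rightarrow> real^'n^'n \<Rightarrow> real^'m^'n \<Rightarrow> (real^'m) set \<Rightarrow>
     real^'n \<Rightarrow> real^'m \<Rightarrow> real^'n \<Rightarrow> bool" where
  "first_order_conditions J R Q B U x u l \<longleftrightarrow>
     0 = ((J - R) ** Q) *v x + B *v u \<and>
     0 = - (B *v u) + (J + R) *v l \<and>
     (\<forall>v\<in>U. u \<bullet> (transpose B *v (Q *v x + l)) \<le> v \<bullet> (transpose B *v (Q *v x + l)))"

definition optimal_steady_state ::
    "real^'n^'n \<Rightarrow> real^'n^'n \<Rightarrow> real^'n^'n \<Rightarrow> real^'m^'n \<Rightarrow> (real^'m) set \<Rightarrow>
     real^'n \<Rightarrow> real^'m \<Rightarrow> real^'n \<Rightarrow> bool" where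
  "optimal_steady_state J R Q B U x u l \<longleftrightarrow>
     solves_steady_state_problem J R Q B U x u \<and> first_order_conditions J R Q B U x u l"

end

theory Submission
  imports Defs
begin

text \<open>
  Put z = Q x and w = z + l. Eliminating B u from the two equations gives J w = R (z - l), and
  hence 2 w \<bullet> (B u) = w \<bullet> (R w) + (z - l) \<bullet> (R (z - l)), which is nonnegative.
  Testing the variational inequality with v = 0 gives w \<bullet> (B u) \<le> 0, so both quadratic
  forms vanish. Semidefiniteness yields R w = R (z - l) = 0, thus J w = 0 as well. The linear
  functional v \<mapsto> v \<bullet> (transpose B w) is now nonnegative near 0, so it is zero. Finally, w lies in
  the kernels of J - R, of transpose B and of transpose ((J - R) Q), so it is orthogonal
  to every column of the controllability matrix.
\<close>

lemma matrix_vector_mult_inner_left: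
  fixes A :: "real^'n^'m"
  shows "(A *v x) \<bullet> y = x \<bullet> (transpose A *v y)"
  by (metis dot_lmul_matrix inner_commute transpose_matrix_vector transpose_transpose)

lemma matrix_vector_mult_minus_left:
  fixes A :: "'a::ring_1^'n^'m"
  shows "(- A) *v x = - (A *v x)"
  by (simp add: matrix_vector_mult_def vec_eq_iff sum_negf)

text \<open>With y = R x, the form along \<open>x - t *\<^sub>R y\<close> has no constant term and
  slope -2 (y \<bullet> y) at t = 0, so it would turn negative for small t > 0 unless y = 0.\<close>

lemma sym_pos_semidef_mult_eq_0:
  assumes R: "sym_pos_semidef R" and x: "x \<bullet> (R *v x) = 0"
  shows "R *v x = 0"
proof -
  define y where "y = R *v x"
  define c where "c = y \<bullet> (R *v y)"
  define N where "N = y \<bullet> y"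
  \<comment> \<open>The summand 1 keeps the denominator positive even if c = 0, and N = t (c + 1)
    turns t c - 2 N into - t (c + 2).\<close>
  define t where "t = N / (c + 1)"
  have sym: "transpose R = R" and nonneg: "0 \<le> v \<bullet> (R *v v)" for v
    using R by (auto simp: sym_pos_semidef_def symmetric_matrix_def)
  have c: "c \<ge> 0"
    unfolding c_def by (rule nonneg)
  have xRy: "x \<bullet> (R *v y) = N"
    using matrix_vector_mult_inner_left[of R x y] by (simp add: sym N_def y_def)
  have "0 \<le> (x - t *\<^sub>R y) \<bullet> (R *v (x - t *\<^sub>R y))"
    by (rule nonneg)
  also have "\<dots> = t * (t * c - 2 * N)"
    using x xRy
    by (simp add: matrix_vector_mult_diff_distrib scaleR_matrix_vector_assoc[symmetric]
        matrix_vector_mult_scaleR inner_diff_left inner_diff_right algebra_simps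
        flip: y_def c_def N_def)
  finally have le: "0 \<le> t * (t * c - 2 * N)" .
  have t: "t * (c + 1) = N"
    using c by (simp add: t_def)
  have "t * (t * c - 2 * N) = - (t\<^sup>2 * (c + 2))"
    unfolding t[symmetric] by (simp add: algebra_simps power2_eq_square)
  with le have "t\<^sup>2 * (c + 2) \<le> 0"
    by linarith
  with c have "t = 0"
    by (simp add: mult_le_0_iff)
  with t show ?thesis
    by (simp add: N_def y_def)
qed

lemma nonneg_inner_near_0_imp_eq_0:
  fixes a :: "'a :: real_inner"
  assumes "0 \<in> interior U" and nonneg: "\<And>v. v \<in> U \<Longrightarrow> 0 \<le> v \<bullet> a"
  shows "a = 0"
proof (rule ccontr)
  assume a: "a \<noteq> 0"
  obtain e where e: "e > 0" "cball 0 e \<subseteq> U"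
    using assms(1) mem_interior_cball by blast
  \<comment> \<open>The point of norm e opposite to a: it stays in the ball, yet pairs with a to - e
    * norm a < 0.\<close>
  define v where "v = - (e / norm a) *\<^sub>R a"
  have "v \<in> U"
    using a e by (auto simp: v_def subset_eq)
  then have "(e / norm a) * (a \<bullet> a) \<le> 0"
    using nonneg[of v] by (simp add: v_def)
  moreover have "(e / norm a) * (a \<bullet> a) > 0"
    using a e by (intro mult_pos_pos) auto
  ultimately show False
    by simp
qed

text \<open>Such a w is orthogonal to every column of the controllability matrix, whose full row
  rank makes its transpose injective.\<close>

lemma controllable_annihilator_eq_0:
  fixes A :: "real^'n^'n" and B :: "real^'m^'n"
  assumes ctrl: "controllable A B" and A: "transpose A *v w = 0" and B: "transpose B *v w = 0"
  shows "w = 0"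
proof -
  let ?C = "controllability_matrix A B"
  have block: "transpose (matrix_power A k ** B) *v w = 0" for k
  proof (cases k)
    case 0
    then show ?thesis
      using B by simp
  next
    case (Suc i)
    then show ?thesis
      using A by (simp add: matrix_transpose_mul flip: matrix_vector_mul_assoc)
  qed
  have "(transpose ?C *v w) $ p =
      (transpose (matrix_power A (to_nat_on UNIV (fst p)) ** B) *v w) $ snd p" for p
    by (simp add: controllability_matrix_def matrix_vector_mult_def transpose_def)
  then have "transpose ?C *v w = 0"
    by (simp add: vec_eq_iff block del: transpose_matrix_vector)
  moreover have "inj ((*v) (transpose ?C))"
    using ctrl by (simp add: controllable_def rank_transpose flip: full_rank_injective)
  ultimately show ?thesis
    by (metis injD matrix_vector_mult_0_right)
qed

theorem theorem12:
  fixes J R Q :: "real^'n^'n" and B :: "real^'m^'n"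
    and u_lo u_hi :: "real^'m" and U :: "(real^'m) set"
    and x l :: "real^'n" and u :: "real^'m"
  assumes "skew_symmetric_matrix J"
    and "sym_pos_semidef R"
    and "sym_pos_def Q"
    and "CARD('m) \<le> CARD('n)" and "rank B = CARD('m)"
    and "U = cbox u_lo u_hi" and "0 \<in> interior U"
    and "optimal_steady_state J R Q B U x u l"
  shows "transpose B *v (Q *v x + l) = 0 \<and>
    J *v (Q *v x + l) = 0 \<and> R *v l = 0 \<and> (R ** Q) *v x = 0 \<and>
    (invertible (J - R) \<or> controllable ((J - R) ** Q) B \<longrightarrow> Q *v x + l = 0)"
proof -
  define z where "z = Q *v x"
  define w where "w = z + l"
  define d where "d = z - l"
  have J: "transpose J = - J"
    using assms(1) by (simp add: skew_symmetric_matrix_def)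
  have R: "transpose R = R" and R_nonneg: "0 \<le> v \<bullet> (R *v v)" for v
    using assms(2) by (auto simp: sym_pos_semidef_def symmetric_matrix_def)
  have foc: "first_order_conditions J R Q B U x u l"
    using assms(8) by (simp add: optimal_steady_state_def)
  have Bu_z: "B *v u = R *v z - J *v z" and Bu_l: "B *v u = J *v l + R *v l"
    using foc
    by (simp_all add: first_order_conditions_def z_def matrix_vector_mult_diff_rdistrib
        matrix_vector_mult_add_rdistrib algebra_simps add_eq_0_iff
        flip: matrix_vector_mul_assoc)
  have vi: "u \<bullet> (transpose B *v w) \<le> v \<bullet> (transpose B *v w)" if "v \<in> U" for v
    using foc that by (simp add: first_order_conditions_def w_def z_def)
  have uBw: "u \<bullet> (transpose B *v w) = w \<bullet> (B *v u)"
    by (metis inner_commute matrix_vector_mult_inner_left)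
  have "R *v z - J *v z = J *v l + R *v l"
    using Bu_z Bu_l by simp
  then have Jw: "J *v w = R *v d"
    by (simp add: w_def d_def matrix_vector_right_distrib
        matrix_vector_mult_diff_distrib algebra_simps)
  \<comment> \<open>Adding the two expressions for B u, rather than equating them, brings out the
    quadratic form of R at w.\<close>
  have "2 *\<^sub>R (B *v u) = (R *v z - J *v z) + (J *v l + R *v l)"
    unfolding scaleR_2 by (metis Bu_z Bu_l)
  also have "\<dots> = R *v w - J *v d"
    by (simp add: w_def d_def matrix_vector_right_distrib matrix_vector_mult_diff_distrib)
  finally have "2 * (w \<bullet> (B *v u)) = w \<bullet> (R *v w) - w \<bullet> (J *v d)"
    by (metis inner_diff_right inner_scaleR_right)
  \<comment> \<open>Skew-symmetry moves J onto w, where J w = R d applies.\<close>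
  moreover have "w \<bullet> (J *v d) = - (d \<bullet> (R *v d))"
  proof -
    have "(J *v w) \<bullet> d = - (w \<bullet> (J *v d))"
      using matrix_vector_mult_inner_left[of J w d]
      by (simp add: J matrix_vector_mult_minus_left del: transpose_matrix_vector)
    then show ?thesis
      by (simp add: Jw inner_commute)
  qed
  ultimately have energy: "2 * (w \<bullet> (B *v u)) = w \<bullet> (R *v w) + d \<bullet> (R *v d)"
    by simp
  have "w \<bullet> (B *v u) \<le> 0"
    using vi[of 0] assms(7) interior_subset uBw by auto
  then have wRw: "w \<bullet> (R *v w) = 0" and dRd: "d \<bullet> (R *v d) = 0" and wBu: "w \<bullet> (B *v u) = 0"
    using energy R_nonneg[of w] R_nonneg[of d] by linarith+
  have Rw: "R *v w = 0" and Rd: "R *v d = 0"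
    using sym_pos_semidef_mult_eq_0[OF assms(2)] wRw dRd by auto
  \<comment> \<open>Both z and l are combinations of w and d, so R kills them too.\<close>
  have z: "z = (1/2) *\<^sub>R (w + d)" and l: "l = (1/2) *\<^sub>R (w - d)"
    by (simp_all add: w_def d_def flip: scaleR_2)
  have Rz: "R *v z = 0" and Rl: "R *v l = 0"
    unfolding z l
    by (simp_all add: matrix_vector_mult_scaleR matrix_vector_right_distrib
        matrix_vector_mult_diff_distrib Rw Rd)
  have Jw0: "J *v w = 0"
    using Jw Rd by simp
  \<comment> \<open>The left side of \<open>vi\<close> equals w \<bullet> (B u) = 0, so
    \<open>vi\<close> states nonnegativity on all of U.\<close>
  have Bw: "transpose B *v w = 0"
    using assms(7) by (rule nonneg_inner_near_0_imp_eq_0) (use vi uBw wBu in auto)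
  have w0: "w = 0" if "invertible (J - R) \<or> controllable ((J - R) ** Q) B"
    using that
  proof
    assume "invertible (J - R)"
    moreover have "(J - R) *v w = 0"
      by (simp add: matrix_vector_mult_diff_rdistrib Jw0 Rw)
    ultimately show ?thesis
      by (metis invertible_def matrix_left_invertible_ker)
  next
    assume ctrl: "controllable ((J - R) ** Q) B"
    have "transpose (J - R) = transpose J - transpose R"
      by (simp add: transpose_def vec_eq_iff)
    \<comment> \<open>The transpose differs from J - R in the sign of J, but it still kills w
      because J w and R w vanish separately.\<close>
    then have "transpose (J - R) = - J - R"
      by (simp add: J R)
    then have "transpose ((J - R) ** Q) *v w = transpose Q *v ((- J - R) *v w)"
      by (simp add: matrix_transpose_mul matrix_vector_mul_assoc del: transpose_matrix_vector)
    also have "\<dots> = 0"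
      by (simp add: matrix_vector_mult_diff_rdistrib matrix_vector_mult_minus_left Jw0 Rw
          del: transpose_matrix_vector)
    finally show ?thesis
      using controllable_annihilator_eq_0[OF ctrl] Bw by blast
  qed
  show ?thesis
    using Bw Jw0 Rl Rz w0 unfolding w_def z_def matrix_vector_mul_assoc by blast
qed

end
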